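(* Let $\mathcal{A}$ be an LE-$\mathcal{ALC}$ ABox whose completion $\overline{\mathcal{A}}$ contains no clash. Then the model $M=(\mathbb{F},\cdot^{\mathrm I})$ constructed from $\overline{\mathcal{A}}$ as in the context satisfies $\mathcal{A}$.
   Context: **Syntax.** Fix disjoint sets $\mathsf{OBJ}$ and $\mathsf{FEAT}$ of individual names (objects $a,b$, resp. features $x,y$), a set $\mathcal{C}$ of atomic concept names, and role names: a single $I$, a finite set $\mathcal{R}_\Box$ of names $R_\Box$, and a finite set $\mathcal{R}_\Diamond$ of names $R_\Diamond$. LE-$\mathcal{ALC}$ concepts are $C ::= D \mid C_1\wedge C_2\mid C_1\vee C_2\mid \langle R_\Diamond\rangle C\mid [R_\Box]C$ with $D\in\mathcal{C}$, $R_\Box\in\mathcal{R}_\Box$, $R_\Diamond\in\mathcal{R}_\Diamond$. ABox terms are $aR_\Box x$, $xR_\Diamond a$, $aIx$ (these three are the relational terms), $a:C$, $x::C$, and $\neg\alpha$ for $\alpha$ any of the five preceding kinds. An ABox is a finite set of ABox terms. A concept $C'$ occurs in $\mathcal{A}$ if $C'$ is a subformula of some $C$ such that $a:C$, $x::C$, $\neg(a:C)$ or $\neg(x::C)$ is in $\mathcal{A}$ for some $a$ or $x$. **Semantics.** For $T\subseteq U\times V$, $U'\subseteq U$, $V'\subseteq V$: $T^{(1)}[U']=\{v\mid \forall u\in U',\ uTv\}$, $T^{(0)}[V']=\{u\mid\forall v\in V',\ uTv\}$ (for singletons write $T^{(1)}[u]$, $T^{(0)}[v]$). A formal context is $\mathbb{P}=(A,X,I)$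 with $I\subseteq A\times X$; $B^\uparrow=I^{(1)}[B]$, $Y^\downarrow=I^{(0)}[Y]$. $B\subseteq A$ (resp. $Y\subseteq X$) is Galois-stable if $B^{\uparrow\downarrow}=B$ (resp. $Y^{\downarrow\uparrow}=Y$). A formal concept is $c=(B,Y)$ with $B=Y^\downarrow$, $Y=B^\uparrow$; write $[\![c]\!]=B$ and $(\![c]\!)=Y$. Formal concepts ordered by inclusion of $[\![\cdot]\!]$ form a complete lattice $\mathbb{P}^+$. An enriched formal context is $\mathbb{F}=(\mathbb{P},\mathcal{R}_\Box,\mathcal{R}_\Diamond)$ with relations $R_\Box\subseteq A\times X$, $R_\Diamond\subseteq X\times A$ that are $I$-compatible: $R_\Box^{(0)}[x],R_\Box^{(1)}[a],R_\Diamond^{(0)}[a],R_\Diamond^{(1)}[x]$ are Galois-stable for all $a\in A,x\in X$. Operations on $\mathbb{P}^+$: $[R_\Box]c$ is the formal concept with extension $R_\Box^{(0)}[(\![c]\!)]$, and $\langle R_\Diamond\rangle c$ is the formal concept with intension $R_\Diamond^{(0)}[[\![c]\!]]$. An interpretation $(\mathbb{F},\cdot^{\mathrm I})$ maps object (feature) names to elements of $A$ (of $X$), role names to the corresponding relations of $\mathbb{F}$, atomic concept names to elements of $\mathbb{P}^+$, and extends to concepts homomorphically ($\wedge,\vee$ as meet and join of $\mathbb{P}^+$, and $[R_\Box],\langle R_\Diamond\rangle$ as the operations above). Satisfaction: $a:C$ iff $a^{\mathrm I}\in[\![C^{\mathrm I}]\!]$; $x::C$ iff $x^{\mathrm I}\in(\![C^{\mathrm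 I}]\!)$; relational terms iff the corresponding elements are so related; $\neg\alpha$ iff $\alpha$ is not satisfied. An interpretation satisfies (is a model of) an ABox if it satisfies all its terms. **Special individuals.** During expansion new individuals may be introduced: objects $a_C$ and features $x_C$ for concepts $C$; for each object $b$, objects $⧫ b$ (one for each $R_\Box$) and $\Diamond b$ (one for each $R_\Diamond$); for each feature $y$, features $\Box y$ (one for each $R_\Box$) and $\blacksquare y$ (one for each $R_\Diamond$). These are new and pairwise distinct (not occurring in the input ABox), except that $\Diamond a_C$ (for $R_\Diamond$) is $a_{\langle R_\Diamond\rangle C}$ and $\Box x_C$ (for $R_\Box$) is $x_{[R_\Box]C}$. **Expansion rules** (from the premises in the current ABox, add the conclusions; $b$ ranges over objects, $y$ and $x$ over features, and $\Box,⧫$ are those of the $R_\Box$ in the rule, $\Diamond,\blacksquare$ those of the $R_\Diamond$ in the rule): - creation: for any $C$ occurring in the current ABox, add $a_C:C$ and $x_C::C$; - basic ($I$): from $b:C$ and $y::C$ add $bIy$; - $\wedge_A$: from $b:C_1\wedge C_2$ add $b:C_1$, $b:C_2$; $\vee_X$: from $y::C_1\vee C_2$ add $y::C_1$, $y::C_2$; - $\Box$: from $b:[R_\Box]C$ and $y::C$ add $bR_\Box y$; $\Diamond$: from $y::\langle R_\Diamond\rangle C$ and $b:C$ add $yR_\Diamond b$; - $I$-compatibility: from $bI\Box y$ add $bR_\Box y$; from $bI\blacksquare y$ add $yR_\Diamond b$; from $\Diamond bIy$ add $yR_\Diamond b$; from $⧫ bIy$ add $bR_\Box y$; - $\wedge_A^{-1}$: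 from $b:C_1$ and $b:C_2$, if $C_1\wedge C_2$ occurs in the current ABox, add $b:C_1\wedge C_2$; $\vee_X^{-1}$: from $y::C_1$ and $y::C_2$, if $C_1\vee C_2$ occurs in the current ABox, add $y::C_1\vee C_2$; - adjunction: from $bR_\Box y$ add $⧫ bIy$ and $bI\Box y$; from $yR_\Diamond b$ add $\Diamond bIy$ and $bI\blacksquare y$; - negative: from $\neg(b:C)$ add $\neg(bIx_C)$; from $\neg(x::C)$ add $\neg(a_CIx)$; - appending: from $bIx_C$ add $b:C$; from $a_CIy$ add $y::C$. The completion $\overline{\mathcal{A}}$ is the maximal expansion of $\mathcal{A}$, i.e. the finite set obtained by applying the expansion rules until none adds a new term. An ABox contains a clash if it contains both $\beta$ and $\neg\beta$ for some relational term $\beta$. **Construction of $M$.** $A$ and $X$ are the sets of object names and feature names occurring in $\overline{\mathcal{A}}$, together with a new element $a_\top\in A$ and a new element $x_\bot\in X$, neither of which is related to anything by any relation. For all other $a\in A$, $x\in X$: $aIx$, $aR_\Box x$, $xR_\Diamond a$ hold iff the respective relational term is in $\overline{\mathcal{A}}$. $\mathbb{F}=(A,X,I,\mathcal{R}_\Box,\mathcal{R}_\Diamond)$. Individual names occurring in $\overline{\mathcal{A}}$ are interpreted as themselves, and each atomic concept $D$ occurring in $\overline{\mathcal{A}}$ as $D^{\mathrm I}=(x_D^{\downarrow},a_D^{\uparrow})$; names not occurring in $\overline{\mathcal{A}}$ are interpreted arbitrarily. *)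

theory Defs
  imports Main
begin

section \<open>Syntax\<close>

text \<open>
  The type parameters are: \<open>'o\<close>, \<open>'f\<close> for the object and feature names available to an input ABox,
  \<open>'c\<close> for the atomic concept names, and \<open>'rb\<close>, \<open>'rd\<close> for names of box and diamond roles. The finite
  sets of role names of the language are explicit subsets \<open>RB\<close>, \<open>RD\<close> of the latter two types.
\<close>

datatype ('c, concept_boxes: 'rb, concept_dias: 'rd) concept =
    Atom 'c
  | And "('c, 'rb, 'rd) concept" "('c, 'rb, 'rd) concept"
  | Or "('c, 'rb, 'rd) concept" "('c, 'rb, 'rd) concept"
  | Dia 'rd "('c, 'rb, 'rd) concept"
  | Box 'rb "('c, 'rb, 'rd) concept"

primrec subconcepts :: "('c, 'rb, 'rd) concept \<Rightarrow> ('c, 'rb, 'rd) concept set" where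
  "subconcepts (Atom D) = {Atom D}"
| "subconcepts (And C1 C2) = insert (And C1 C2) (subconcepts C1 \<union> subconcepts C2)"
| "subconcepts (Or C1 C2) = insert (Or C1 C2) (subconcepts C1 \<union> subconcepts C2)"
| "subconcepts (Dia R C) = insert (Dia R C) (subconcepts C)"
| "subconcepts (Box R C) = insert (Box R C) (subconcepts C)"

text \<open>
  Individual names: \<open>Obj a\<close> and \<open>Feat x\<close> are the names of the input, all others are the special
  individuals. Freeness of the constructors makes the special individuals new and pairwise distinct.
  The two exceptional identifications are built into \<open>dia_obj\<close> and \<open>box_feat\<close> below, which
  must be used in place of the constructors \<open>DiaObj\<close> and \<open>BoxFeat\<close>; the terms
  \<open>DiaObj R (ACon C)\<close> and \<open>BoxFeat R (XCon C)\<close> are not names of anything.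
\<close>

datatype ('o, 'c, 'rb, 'rd) obj =
    Obj 'o
  | ACon "('c, 'rb, 'rd) concept"
  | BDiaObj 'rb "('o, 'c, 'rb, 'rd) obj"
  | DiaObj 'rd "('o, 'c, 'rb, 'rd) obj"

datatype ('f, 'c, 'rb, 'rd) feat =
    Feat 'f
  | XCon "('c, 'rb, 'rd) concept"
  | BoxFeat 'rb "('f, 'c, 'rb, 'rd) feat"
  | BBoxFeat 'rd "('f, 'c, 'rb, 'rd) feat"

definition dia_obj :: "'rd \<Rightarrow> ('o, 'c, 'rb, 'rd) obj \<Rightarrow> ('o, 'c, 'rb, 'rd) obj" where
  "dia_obj R b = (case b of ACon C \<Rightarrow> ACon (Dia R C) | _ \<Rightarrow> DiaObj R b)"

definition box_feat :: "'rb \<Rightarrow> ('f, 'c, 'rb, 'rd) feat \<Rightarrow> ('f, 'c, 'rb, 'rd) feat" where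
  "box_feat R y = (case y of XCon C \<Rightarrow> XCon (Box R C) | _ \<Rightarrow> BoxFeat R y)"

datatype ('o, 'f, 'c, assertion_boxes: 'rb, assertion_dias: 'rd) assertion =
    BoxRel 'rb "('o, 'c, 'rb, 'rd) obj" "('f, 'c, 'rb, 'rd) feat"
  | DiaRel 'rd "('f, 'c, 'rb, 'rd) feat" "('o, 'c, 'rb, 'rd) obj"
  | IncRel "('o, 'c, 'rb, 'rd) obj" "('f, 'c, 'rb, 'rd) feat"
  | ObjIn "('o, 'c, 'rb, 'rd) obj" "('c, 'rb, 'rd) concept"
  | FeatIn "('f, 'c, 'rb, 'rd) feat" "('c, 'rb, 'rd) concept"

datatype ('o, 'f, 'c, 'rb, 'rd) abox_term =
    Pos (assertion: "('o, 'f, 'c, 'rb, 'rd) assertion")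
  | Neg (assertion: "('o, 'f, 'c, 'rb, 'rd) assertion")

type_synonym ('o, 'f, 'c, 'rb, 'rd) abox = "('o, 'f, 'c, 'rb, 'rd) abox_term set"

primrec relational :: "('o, 'f, 'c, 'rb, 'rd) assertion \<Rightarrow> bool" where
  "relational (BoxRel R b y) = True"
| "relational (DiaRel R y b) = True"
| "relational (IncRel b y) = True"
| "relational (ObjIn b C) = False"
| "relational (FeatIn y C) = False"

primrec assertion_objs :: "('o, 'f, 'c, 'rb, 'rd) assertion \<Rightarrow> ('o, 'c, 'rb, 'rd) obj set" where
  "assertion_objs (BoxRel R b y) = {b}"
| "assertion_objs (DiaRel R y b) = {b}"
| "assertion_objs (IncRel b y) = {b}"
| "assertion_objs (ObjIn b C) = {b}"
| "assertion_objs (FeatIn y C) = {}"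

primrec assertion_feats :: "('o, 'f, 'c, 'rb, 'rd) assertion \<Rightarrow> ('f, 'c, 'rb, 'rd) feat set" where
  "assertion_feats (BoxRel R b y) = {y}"
| "assertion_feats (DiaRel R y b) = {y}"
| "assertion_feats (IncRel b y) = {y}"
| "assertion_feats (ObjIn b C) = {}"
| "assertion_feats (FeatIn y C) = {y}"

primrec assertion_concepts ::
    "('o, 'f, 'c, 'rb, 'rd) assertion \<Rightarrow> ('c, 'rb, 'rd) concept set" where
  "assertion_concepts (BoxRel R b y) = {}"
| "assertion_concepts (DiaRel R y b) = {}"
| "assertion_concepts (IncRel b y) = {}"
| "assertion_concepts (ObjIn b C) = {C}"
| "assertion_concepts (FeatIn y C) = {C}"

definition obj_names :: "('o, 'f, 'c, 'rb, 'rd) abox \<Rightarrow> ('o, 'c, 'rb, 'rd) obj set" where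
  "obj_names B = (\<Union>t\<in>B. assertion_objs (assertion t))"

definition feat_names :: "('o, 'f, 'c, 'rb, 'rd) abox \<Rightarrow> ('f, 'c, 'rb, 'rd) feat set" where
  "feat_names B = (\<Union>t\<in>B. assertion_feats (assertion t))"

definition occurring :: "('o, 'f, 'c, 'rb, 'rd) abox \<Rightarrow> ('c, 'rb, 'rd) concept set" where
  "occurring B = (\<Union>t\<in>B. \<Union>C\<in>assertion_concepts (assertion t). subconcepts C)"

text \<open>An input ABox over the roles \<open>RB\<close>, \<open>RD\<close>; no special individual occurs in it.\<close>

definition input_abox :: "'rb set \<Rightarrow> 'rd set \<Rightarrow> ('o, 'f, 'c, 'rb, 'rd) abox \<Rightarrow> bool" where
  "input_abox RB RD B \<longleftrightarrow>
     finite B \<and> obj_names B \<subseteq> range Obj \<and> feat_names B \<subseteq> range Feat \<and>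
     (\<forall>t\<in>B. assertion_boxes (assertion t) \<subseteq> RB \<and> assertion_dias (assertion t) \<subseteq> RD)"


section \<open>Semantics\<close>

text \<open>
  \<open>polar1 V T U'\<close> and \<open>polar0 U T V'\<close> are \<open>T\<^sup>(\<^sup>1\<^sup>)[U']\<close> and \<open>T\<^sup>(\<^sup>0\<^sup>)[V']\<close> for \<open>T \<subseteq> U \<times> V\<close>.
  The carrier has to be given since all of it is obtained from the empty set.
\<close>

definition polar1 :: "'v set \<Rightarrow> ('u \<times> 'v) set \<Rightarrow> 'u set \<Rightarrow> 'v set" where
  "polar1 V T U' = {v \<in> V. \<forall>u\<in>U'. (u, v) \<in> T}"

definition polar0 :: "'u set \<Rightarrow> ('u \<times> 'v) set \<Rightarrow> 'v set \<Rightarrow> 'u set" where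
  "polar0 U T V' = {u \<in> U. \<forall>v\<in>V'. (u, v) \<in> T}"

record ('a, 'b) fcontext =
  objs :: "'a set"
  feats :: "'b set"
  inc :: "('a \<times> 'b) set"

record ('a, 'b, 'rb, 'rd) frame = "('a, 'b) fcontext" +
  rbox :: "'rb \<Rightarrow> ('a \<times> 'b) set"
  rdia :: "'rd \<Rightarrow> ('b \<times> 'a) set"

definition up :: "('a, 'b, 'z) fcontext_scheme \<Rightarrow> 'a set \<Rightarrow> 'b set" where
  "up P B = polar1 (feats P) (inc P) B"

definition down :: "('a, 'b, 'z) fcontext_scheme \<Rightarrow> 'b set \<Rightarrow> 'a set" where
  "down P Y = polar0 (objs P) (inc P) Y"

definition formal_context :: "('a, 'b, 'z) fcontext_scheme \<Rightarrow> bool" where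
  "formal_context P \<longleftrightarrow> inc P \<subseteq> objs P \<times> feats P"

definition stable_objs :: "('a, 'b, 'z) fcontext_scheme \<Rightarrow> 'a set \<Rightarrow> bool" where
  "stable_objs P B \<longleftrightarrow> B \<subseteq> objs P \<and> down P (up P B) = B"

definition stable_feats :: "('a, 'b, 'z) fcontext_scheme \<Rightarrow> 'b set \<Rightarrow> bool" where
  "stable_feats P Y \<longleftrightarrow> Y \<subseteq> feats P \<and> up P (down P Y) = Y"

text \<open>Pairs \<open>c\<close> with extension \<open>fst c\<close> and intension \<open>snd c\<close>.\<close>

definition formal_concept :: "('a, 'b, 'z) fcontext_scheme \<Rightarrow> 'a set \<times> 'b set \<Rightarrow> bool" where
  "formal_concept P c \<longleftrightarrow>
     fst c \<subseteq> objs P \<and> snd c \<subseteq> feats P \<and> fst c = down P (snd c) \<and> snd c = up P (fst c)"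

definition enriched_context ::
    "'rb set \<Rightarrow> 'rd set \<Rightarrow> ('a, 'b, 'rb, 'rd, 'z) frame_scheme \<Rightarrow> bool" where
  "enriched_context RB RD F \<longleftrightarrow>
     formal_context F \<and>
     (\<forall>R\<in>RB. rbox F R \<subseteq> objs F \<times> feats F \<and>
        (\<forall>x\<in>feats F. stable_objs F (polar0 (objs F) (rbox F R) {x})) \<and>
        (\<forall>a\<in>objs F. stable_feats F (polar1 (feats F) (rbox F R) {a}))) \<and>
     (\<forall>R\<in>RD. rdia F R \<subseteq> feats F \<times> objs F \<and>
        (\<forall>a\<in>objs F. stable_feats F (polar0 (feats F) (rdia F R) {a})) \<and>
        (\<forall>x\<in>feats F. stable_objs F (polar1 (objs F) (rdia F R) {x})))"

text \<open>
  Operations of the concept lattice. That \<open>concept_meet\<close> and \<open>concept_join\<close> are the infimum and the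
  supremum for the inclusion order of extensions, and that all four operations yield formal concepts,
  is proved at the end of this section.
\<close>

definition concept_meet ::
    "('a, 'b, 'z) fcontext_scheme \<Rightarrow> 'a set \<times> 'b set \<Rightarrow> 'a set \<times> 'b set \<Rightarrow> 'a set \<times> 'b set" where
  "concept_meet P c d = (fst c \<inter> fst d, up P (fst c \<inter> fst d))"

definition concept_join ::
    "('a, 'b, 'z) fcontext_scheme \<Rightarrow> 'a set \<times> 'b set \<Rightarrow> 'a set \<times> 'b set \<Rightarrow> 'a set \<times> 'b set" where
  "concept_join P c d = (down P (snd c \<inter> snd d), snd c \<inter> snd d)"

definition concept_box ::
    "('a, 'b, 'rb, 'rd, 'z) frame_scheme \<Rightarrow> 'rb \<Rightarrow> 'a set \<times> 'b set \<Rightarrow> 'a set \<times> 'b set" where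
  "concept_box F R c =
     (polar0 (objs F) (rbox F R) (snd c), up F (polar0 (objs F) (rbox F R) (snd c)))"

definition concept_dia ::
    "('a, 'b, 'rb, 'rd, 'z) frame_scheme \<Rightarrow> 'rd \<Rightarrow> 'a set \<times> 'b set \<Rightarrow> 'a set \<times> 'b set" where
  "concept_dia F R c =
     (down F (polar0 (feats F) (rdia F R) (fst c)), polar0 (feats F) (rdia F R) (fst c))"

record ('a, 'b, 'o, 'f, 'c, 'rb, 'rd) interp =
  frm :: "('a, 'b, 'rb, 'rd) frame"
  iobj :: "('o, 'c, 'rb, 'rd) obj \<Rightarrow> 'a"
  ifeat :: "('f, 'c, 'rb, 'rd) feat \<Rightarrow> 'b"
  iatom :: "'c \<Rightarrow> 'a set \<times> 'b set"

definition is_interp ::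
    "'rb set \<Rightarrow> 'rd set \<Rightarrow> ('a, 'b, 'o, 'f, 'c, 'rb, 'rd) interp \<Rightarrow> bool" where
  "is_interp RB RD M \<longleftrightarrow>
     enriched_context RB RD (frm M) \<and>
     (\<forall>a. iobj M a \<in> objs (frm M)) \<and>
     (\<forall>x. ifeat M x \<in> feats (frm M)) \<and>
     (\<forall>D. formal_concept (frm M) (iatom M D))"

primrec iconcept ::
    "('a, 'b, 'o, 'f, 'c, 'rb, 'rd) interp \<Rightarrow> ('c, 'rb, 'rd) concept \<Rightarrow> 'a set \<times> 'b set" where
  "iconcept M (Atom D) = iatom M D"
| "iconcept M (And C1 C2) = concept_meet (frm M) (iconcept M C1) (iconcept M C2)"
| "iconcept M (Or C1 C2) = concept_join (frm M) (iconcept M C1) (iconcept M C2)"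
| "iconcept M (Dia R C) = concept_dia (frm M) R (iconcept M C)"
| "iconcept M (Box R C) = concept_box (frm M) R (iconcept M C)"

primrec sat_assertion ::
    "('a, 'b, 'o, 'f, 'c, 'rb, 'rd) interp \<Rightarrow> ('o, 'f, 'c, 'rb, 'rd) assertion \<Rightarrow> bool" where
  "sat_assertion M (BoxRel R b y) \<longleftrightarrow> (iobj M b, ifeat M y) \<in> rbox (frm M) R"
| "sat_assertion M (DiaRel R y b) \<longleftrightarrow> (ifeat M y, iobj M b) \<in> rdia (frm M) R"
| "sat_assertion M (IncRel b y) \<longleftrightarrow> (iobj M b, ifeat M y) \<in> inc (frm M)"
| "sat_assertion M (ObjIn b C) \<longleftrightarrow> iobj M b \<in> fst (iconcept M C)"
| "sat_assertion M (FeatIn y C) \<longleftrightarrow> ifeat M y \<in> snd (iconcept M C)"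

primrec satisfies ::
    "('a, 'b, 'o, 'f, 'c, 'rb, 'rd) interp \<Rightarrow> ('o, 'f, 'c, 'rb, 'rd) abox_term \<Rightarrow> bool" where
  "satisfies M (Pos \<alpha>) \<longleftrightarrow> sat_assertion M \<alpha>"
| "satisfies M (Neg \<alpha>) \<longleftrightarrow> \<not> sat_assertion M \<alpha>"

definition model_of ::
    "'rb set \<Rightarrow> 'rd set \<Rightarrow> ('a, 'b, 'o, 'f, 'c, 'rb, 'rd) interp \<Rightarrow>
     ('o, 'f, 'c, 'rb, 'rd) abox \<Rightarrow> bool" where
  "model_of RB RD M B \<longleftrightarrow> is_interp RB RD M \<and> (\<forall>t\<in>B. satisfies M t)"

lemma up_antimono: "B \<subseteq> B' \<Longrightarrow> up P B' \<subseteq> up P B"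
  by (auto simp: up_def polar1_def)

lemma down_antimono: "Y \<subseteq> Y' \<Longrightarrow> down P Y' \<subseteq> down P Y"
  by (auto simp: down_def polar0_def)

lemma down_up_extensive: "B \<subseteq> objs P \<Longrightarrow> B \<subseteq> down P (up P B)"
  by (auto simp: up_def down_def polar0_def polar1_def)

lemma up_down_extensive: "Y \<subseteq> feats P \<Longrightarrow> Y \<subseteq> up P (down P Y)"
  by (auto simp: up_def down_def polar0_def polar1_def)

lemma formal_concept_extI:
  assumes "B \<subseteq> objs P" "down P (up P B) \<subseteq> B"
  shows "formal_concept P (B, up P B)"
proof -
  have "B = down P (up P B)" using assms down_up_extensive by (metis subset_antisym)
  moreover have "up P B \<subseteq> feats P" by (simp add: up_def polar1_def)
  ultimately show ?thesis using assms(1) by (simp add: formal_concept_def)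
qed

lemma formal_concept_intI:
  assumes "Y \<subseteq> feats P" "up P (down P Y) \<subseteq> Y"
  shows "formal_concept P (down P Y, Y)"
proof -
  have "Y = up P (down P Y)" using assms up_down_extensive by (metis subset_antisym)
  moreover have "down P Y \<subseteq> objs P" by (simp add: down_def polar0_def)
  ultimately show ?thesis using assms(1) by (simp add: formal_concept_def)
qed

lemma formal_concept_ext_stable: "formal_concept P c \<Longrightarrow> down P (up P (fst c)) = fst c"
  by (metis formal_concept_def)

lemma formal_concept_int_stable: "formal_concept P c \<Longrightarrow> up P (down P (snd c)) = snd c"
  by (metis formal_concept_def)

lemma formal_concept_order:
  assumes "formal_concept P c" "formal_concept P d"
  shows "fst c \<subseteq> fst d \<longleftrightarrow> snd d \<subseteq> snd c"
  using assms by (metis formal_concept_def up_antimono down_antimono)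

lemma concept_meet_is_inf:
  assumes "formal_concept P c" "formal_concept P d"
  shows "formal_concept P (concept_meet P c d)"
    and "fst e \<subseteq> fst (concept_meet P c d) \<longleftrightarrow> fst e \<subseteq> fst c \<and> fst e \<subseteq> fst d"
proof -
  let ?E = "fst c \<inter> fst d"
  have "down P (up P ?E) \<subseteq> down P (up P (fst c))" "down P (up P ?E) \<subseteq> down P (up P (fst d))"
    by (intro down_antimono up_antimono Int_lower1 Int_lower2)+
  then have "down P (up P ?E) \<subseteq> ?E"
    unfolding formal_concept_ext_stable[OF assms(1)] formal_concept_ext_stable[OF assms(2)]
    by (rule Int_greatest)
  moreover have "?E \<subseteq> objs P" using assms(1) unfolding formal_concept_def by blast
  ultimately show "formal_concept P (concept_meet P c d)"
    unfolding concept_meet_def by (intro formal_concept_extI)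
qed (simp add: concept_meet_def)

lemma concept_join_is_sup:
  assumes "formal_concept P c" "formal_concept P d"
  shows "formal_concept P (concept_join P c d)"
    and "formal_concept P e \<Longrightarrow>
           fst (concept_join P c d) \<subseteq> fst e \<longleftrightarrow> fst c \<subseteq> fst e \<and> fst d \<subseteq> fst e"
proof -
  let ?E = "snd c \<inter> snd d"
  have "up P (down P ?E) \<subseteq> up P (down P (snd c))" "up P (down P ?E) \<subseteq> up P (down P (snd d))"
    by (intro down_antimono up_antimono Int_lower1 Int_lower2)+
  then have "up P (down P ?E) \<subseteq> ?E"
    unfolding formal_concept_int_stable[OF assms(1)] formal_concept_int_stable[OF assms(2)]
    by (rule Int_greatest)
  moreover have "?E \<subseteq> feats P" using assms(1) unfolding formal_concept_def by blast
  ultimately show join: "formal_concept P (concept_join P c d)"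
    unfolding concept_join_def by (intro formal_concept_intI)
  show "fst (concept_join P c d) \<subseteq> fst e \<longleftrightarrow> fst c \<subseteq> fst e \<and> fst d \<subseteq> fst e"
    if "formal_concept P e"
    unfolding formal_concept_order[OF join that] formal_concept_order[OF assms(1) that]
      formal_concept_order[OF assms(2) that]
    by (simp add: concept_join_def)
qed

lemma concept_box_is_concept:
  assumes "enriched_context RB RD F" "R \<in> RB" "formal_concept F c"
  shows "formal_concept F (concept_box F R c)"
proof -
  let ?E = "polar0 (objs F) (rbox F R) (snd c)"
  have E: "?E \<subseteq> objs F" by (auto simp: polar0_def)
  have "b \<in> ?E" if b: "b \<in> down F (up F ?E)" for b
  proof -
    have "(b, x) \<in> rbox F R" if x: "x \<in> snd c" for x
    proof -
      let ?S = "polar0 (objs F) (rbox F R) {x}"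
      have "x \<in> feats F" using x assms(3) unfolding formal_concept_def by blast
      then have "down F (up F ?S) = ?S"
        using assms(1,2) unfolding enriched_context_def stable_objs_def by blast
      moreover have "?E \<subseteq> ?S" using x by (auto simp: polar0_def)
      then have "down F (up F ?E) \<subseteq> down F (up F ?S)" by (intro down_antimono up_antimono)
      ultimately have "b \<in> ?S" using b by blast
      then show ?thesis by (simp add: polar0_def)
    qed
    moreover have "b \<in> objs F" using b by (simp add: down_def polar0_def)
    ultimately show ?thesis by (simp add: polar0_def)
  qed
  then have "down F (up F ?E) \<subseteq> ?E" by (rule subsetI)
  with E show ?thesis unfolding concept_box_def by (rule formal_concept_extI)
qed

lemma concept_dia_is_concept:
  assumes "enriched_context RB RD F" "R \<in> RD" "formal_concept F c"
  shows "formal_concept F (concept_dia F R c)"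
proof -
  let ?E = "polar0 (feats F) (rdia F R) (fst c)"
  have E: "?E \<subseteq> feats F" by (auto simp: polar0_def)
  have "y \<in> ?E" if y: "y \<in> up F (down F ?E)" for y
  proof -
    have "(y, a) \<in> rdia F R" if a: "a \<in> fst c" for a
    proof -
      let ?S = "polar0 (feats F) (rdia F R) {a}"
      have "a \<in> objs F" using a assms(3) unfolding formal_concept_def by blast
      then have "up F (down F ?S) = ?S"
        using assms(1,2) unfolding enriched_context_def stable_feats_def by blast
      moreover have "?E \<subseteq> ?S" using a by (auto simp: polar0_def)
      then have "up F (down F ?E) \<subseteq> up F (down F ?S)" by (intro down_antimono up_antimono)
      ultimately have "y \<in> ?S" using y by blast
      then show ?thesis by (simp add: polar0_def)
    qed
    moreover have "y \<in> feats F" using y by (simp add: up_def polar1_def)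
    ultimately show ?thesis by (simp add: polar0_def)
  qed
  then have "up F (down F ?E) \<subseteq> ?E" by (rule subsetI)
  with E show ?thesis unfolding concept_dia_def by (rule formal_concept_intI)
qed


section \<open>Expansion rules and completion\<close>

text \<open>\<open>expansion_rule B N\<close>: some rule has its premises in \<open>B\<close>, and \<open>N\<close> is its set of conclusions.\<close>

inductive expansion_rule ::
    "('o, 'f, 'c, 'rb, 'rd) abox \<Rightarrow> ('o, 'f, 'c, 'rb, 'rd) abox \<Rightarrow> bool" for B where
  creation: "C \<in> occurring B \<Longrightarrow>
    expansion_rule B {Pos (ObjIn (ACon C) C), Pos (FeatIn (XCon C) C)}"
| basic: "Pos (ObjIn b C) \<in> B \<Longrightarrow> Pos (FeatIn y C) \<in> B \<Longrightarrow>
    expansion_rule B {Pos (IncRel b y)}"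
| and_A: "Pos (ObjIn b (And C1 C2)) \<in> B \<Longrightarrow>
    expansion_rule B {Pos (ObjIn b C1), Pos (ObjIn b C2)}"
| or_X: "Pos (FeatIn y (Or C1 C2)) \<in> B \<Longrightarrow>
    expansion_rule B {Pos (FeatIn y C1), Pos (FeatIn y C2)}"
| box: "Pos (ObjIn b (Box R C)) \<in> B \<Longrightarrow> Pos (FeatIn y C) \<in> B \<Longrightarrow>
    expansion_rule B {Pos (BoxRel R b y)}"
| dia: "Pos (FeatIn y (Dia R C)) \<in> B \<Longrightarrow> Pos (ObjIn b C) \<in> B \<Longrightarrow>
    expansion_rule B {Pos (DiaRel R y b)}"
| compat_box: "Pos (IncRel b (box_feat R y)) \<in> B \<Longrightarrow> expansion_rule B {Pos (BoxRel R b y)}"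
| compat_bbox: "Pos (IncRel b (BBoxFeat R y)) \<in> B \<Longrightarrow> expansion_rule B {Pos (DiaRel R y b)}"
| compat_dia: "Pos (IncRel (dia_obj R b) y) \<in> B \<Longrightarrow> expansion_rule B {Pos (DiaRel R y b)}"
| compat_bdia: "Pos (IncRel (BDiaObj R b) y) \<in> B \<Longrightarrow> expansion_rule B {Pos (BoxRel R b y)}"
| and_A_inv: "Pos (ObjIn b C1) \<in> B \<Longrightarrow> Pos (ObjIn b C2) \<in> B \<Longrightarrow> And C1 C2 \<in> occurring B \<Longrightarrow>
    expansion_rule B {Pos (ObjIn b (And C1 C2))}"
| or_X_inv: "Pos (FeatIn y C1) \<in> B \<Longrightarrow> Pos (FeatIn y C2) \<in> B \<Longrightarrow> Or C1 C2 \<in> occurring B \<Longrightarrow>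
    expansion_rule B {Pos (FeatIn y (Or C1 C2))}"
| adj_box: "Pos (BoxRel R b y) \<in> B \<Longrightarrow>
    expansion_rule B {Pos (IncRel (BDiaObj R b) y), Pos (IncRel b (box_feat R y))}"
| adj_dia: "Pos (DiaRel R y b) \<in> B \<Longrightarrow>
    expansion_rule B {Pos (IncRel (dia_obj R b) y), Pos (IncRel b (BBoxFeat R y))}"
| neg_obj: "Neg (ObjIn b C) \<in> B \<Longrightarrow> expansion_rule B {Neg (IncRel b (XCon C))}"
| neg_feat: "Neg (FeatIn x C) \<in> B \<Longrightarrow> expansion_rule B {Neg (IncRel (ACon C) x)}"
| append_obj: "Pos (IncRel b (XCon C)) \<in> B \<Longrightarrow> expansion_rule B {Pos (ObjIn b C)}"
| append_feat: "Pos (IncRel (ACon C) y) \<in> B \<Longrightarrow> expansion_rule B {Pos (FeatIn y C)}"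

definition expansion_step ::
    "('o, 'f, 'c, 'rb, 'rd) abox \<Rightarrow> ('o, 'f, 'c, 'rb, 'rd) abox \<Rightarrow> bool" where
  "expansion_step B B' \<longleftrightarrow> (\<exists>N. expansion_rule B N \<and> \<not> N \<subseteq> B \<and> B' = B \<union> N)"

definition saturated :: "('o, 'f, 'c, 'rb, 'rd) abox \<Rightarrow> bool" where
  "saturated B \<longleftrightarrow> (\<nexists>B'. expansion_step B B')"

text \<open>
  The maximal expansion is the union of all ABoxes reachable by expansion steps. It is saturated, and
  it is the result of every expansion sequence that ends in a saturated ABox (lemmas
  \<open>saturated_completion\<close> and \<open>completion_eqI\<close> below), so no appeal to termination is needed.
\<close>

definition completion :: "('o, 'f, 'c, 'rb, 'rd) abox \<Rightarrow> ('o, 'f, 'c, 'rb, 'rd) abox" where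
  "completion B = \<Union> {B'. expansion_step\<^sup>*\<^sup>* B B'}"

definition clash :: "('o, 'f, 'c, 'rb, 'rd) abox \<Rightarrow> bool" where
  "clash B \<longleftrightarrow> (\<exists>\<beta>. relational \<beta> \<and> Pos \<beta> \<in> B \<and> Neg \<beta> \<in> B)"

lemma occurring_mono: "B \<subseteq> B' \<Longrightarrow> occurring B \<subseteq> occurring B'"
  unfolding occurring_def by blast

lemma expansion_rule_mono:
  assumes "expansion_rule B N" "B \<subseteq> B'"
  shows "expansion_rule B' N"
  using assms(1)
  by cases (use assms(2) occurring_mono[OF assms(2)] in \<open>auto intro: expansion_rule.intros\<close>)

lemma expansion_rule_finite_premises:
  assumes "expansion_rule B N"
  shows "\<exists>S. finite S \<and> S \<subseteq> B \<and> expansion_rule S N"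
proof -
  have occ: "\<exists>t\<in>B. C \<in> occurring {t}" if "C \<in> occurring B" for C
    using that unfolding occurring_def by auto
  have occ1: "C \<in> occurring (insert s (insert r {t}))" if "C \<in> occurring {t}" for C s r t
    using that unfolding occurring_def by auto
  have single: ?thesis if "t \<in> B" "expansion_rule {t} N" for t
    using that by (intro exI[of _ "{t}"]) simp
  from assms show ?thesis
  proof cases
    case (creation C)
    with occ obtain t where "t \<in> B" "C \<in> occurring {t}" by blast
    then show ?thesis using creation by (intro exI[of _ "{t}"]) (auto intro: expansion_rule.intros)
  next
    case (basic b C y)
    then show ?thesis
      by (intro exI[of _ "{Pos (ObjIn b C), Pos (FeatIn y C)}"]) (auto intro: expansion_rule.intros)
  next
    case (box b R C y)
    then show ?thesis
      by (intro exI[of _ "{Pos (ObjIn b (Box R C)), Pos (FeatIn y C)}"])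
        (auto intro: expansion_rule.intros)
  next
    case (dia y R C b)
    then show ?thesis
      by (intro exI[of _ "{Pos (FeatIn y (Dia R C)), Pos (ObjIn b C)}"])
        (auto intro: expansion_rule.intros)
  next
    case (and_A_inv b C1 C2)
    with occ obtain t where "t \<in> B" "And C1 C2 \<in> occurring {t}" by blast
    then show ?thesis using and_A_inv occ1
      by (intro exI[of _ "{Pos (ObjIn b C1), Pos (ObjIn b C2), t}"])
        (auto intro!: expansion_rule.and_A_inv)
  next
    case (or_X_inv y C1 C2)
    with occ obtain t where "t \<in> B" "Or C1 C2 \<in> occurring {t}" by blast
    then show ?thesis using or_X_inv occ1
      by (intro exI[of _ "{Pos (FeatIn y C1), Pos (FeatIn y C2), t}"])
        (auto intro!: expansion_rule.or_X_inv)
  next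
    case and_A
    show ?thesis using and_A(1) by (intro single[OF and_A(2)]) (simp add: expansion_rule.and_A)
  next
    case or_X
    show ?thesis using or_X(1) by (intro single[OF or_X(2)]) (simp add: expansion_rule.or_X)
  next
    case compat_box
    show ?thesis using compat_box(1) by (intro single[OF compat_box(2)]) (simp add: expansion_rule.compat_box)
  next
    case compat_bbox
    show ?thesis using compat_bbox(1) by (intro single[OF compat_bbox(2)]) (simp add: expansion_rule.compat_bbox)
  next
    case compat_dia
    show ?thesis using compat_dia(1) by (intro single[OF compat_dia(2)]) (simp add: expansion_rule.compat_dia)
  next
    case compat_bdia
    show ?thesis using compat_bdia(1) by (intro single[OF compat_bdia(2)]) (simp add: expansion_rule.compat_bdia)
  next
    case adj_box
    show ?thesis using adj_box(1) by (intro single[OF adj_box(2)]) (simp add: expansion_rule.adj_box)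
  next
    case adj_dia
    show ?thesis using adj_dia(1) by (intro single[OF adj_dia(2)]) (simp add: expansion_rule.adj_dia)
  next
    case neg_obj
    show ?thesis using neg_obj(1) by (intro single[OF neg_obj(2)]) (simp add: expansion_rule.neg_obj)
  next
    case neg_feat
    show ?thesis using neg_feat(1) by (intro single[OF neg_feat(2)]) (simp add: expansion_rule.neg_feat)
  next
    case append_obj
    show ?thesis using append_obj(1) by (intro single[OF append_obj(2)]) (simp add: expansion_rule.append_obj)
  next
    case append_feat
    show ?thesis using append_feat(1) by (intro single[OF append_feat(2)]) (simp add: expansion_rule.append_feat)
  qed
qed

lemma expansion_step_add:
  assumes "expansion_step\<^sup>*\<^sup>* B B'" "expansion_rule B' N"
  shows "expansion_step\<^sup>*\<^sup>* B (B' \<union> N)"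
proof (cases "N \<subseteq> B'")
  case True
  then show ?thesis using assms(1) by (simp add: Un_absorb2)
next
  case False
  then have "expansion_step B' (B' \<union> N)" using assms(2) by (auto simp: expansion_step_def)
  with assms(1) show ?thesis by (rule rtranclp.rtrancl_into_rtrancl)
qed

lemma expansion_steps_union:
  assumes "expansion_step\<^sup>*\<^sup>* B B1" "expansion_step\<^sup>*\<^sup>* B B2"
  shows "expansion_step\<^sup>*\<^sup>* B (B1 \<union> B2)"
  using assms(2)
proof (induction rule: rtranclp_induct)
  case base
  have "B \<subseteq> B1" using assms(1) by (induction rule: rtranclp_induct) (auto simp: expansion_step_def)
  then show ?case using assms(1) by (simp add: Un_absorb2)
next
  case (step B2 B3)
  then obtain N where N: "expansion_rule B2 N" "B3 = B2 \<union> N" by (auto simp: expansion_step_def)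
  have "expansion_rule (B1 \<union> B2) N" using N(1) by (rule expansion_rule_mono) simp
  from expansion_step_add[OF step.IH this] show ?case using N(2) by (simp add: Un_assoc)
qed

lemma completion_directed:
  assumes "finite S" "S \<subseteq> completion B"
  shows "\<exists>B'. expansion_step\<^sup>*\<^sup>* B B' \<and> S \<subseteq> B'"
  using assms
proof (induction rule: finite_induct)
  case empty
  show ?case by blast
next
  case (insert t S)
  then obtain B1 B2 where "expansion_step\<^sup>*\<^sup>* B B1" "S \<subseteq> B1" "expansion_step\<^sup>*\<^sup>* B B2" "t \<in> B2"
    by (auto simp: completion_def)
  then show ?case by (intro exI[of _ "B1 \<union> B2"]) (auto intro: expansion_steps_union)
qed

lemma completion_closed:
  assumes "expansion_rule (completion B) N"
  shows "N \<subseteq> completion B"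
proof -
  from expansion_rule_finite_premises[OF assms] obtain S
    where "finite S" "S \<subseteq> completion B" "expansion_rule S N" by blast
  then obtain B' where "expansion_step\<^sup>*\<^sup>* B B'" "expansion_rule B' N"
    using completion_directed expansion_rule_mono by metis
  then have "expansion_step\<^sup>*\<^sup>* B (B' \<union> N)" by (rule expansion_step_add)
  then show ?thesis by (auto simp: completion_def)
qed

lemma saturated_completion: "saturated (completion B)"
  using completion_closed by (auto simp: saturated_def expansion_step_def)

lemma completion_eqI:
  assumes "expansion_step\<^sup>*\<^sup>* B B'" "saturated B'"
  shows "completion B = B'"
proof
  show "B' \<subseteq> completion B" using assms(1) by (auto simp: completion_def)
  have "B'' \<subseteq> B'" if "expansion_step\<^sup>*\<^sup>* B B''" for B''
    using that
  proof (induction rule: rtranclp_induct)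
    case base
    show ?case using assms(1) by (induction rule: rtranclp_induct) (auto simp: expansion_step_def)
  next
    case (step B1 B2)
    then obtain N where "expansion_rule B1 N" "B2 = B1 \<union> N" by (auto simp: expansion_step_def)
    moreover from this step.IH have "expansion_rule B' N" by (blast intro: expansion_rule_mono)
    then have "N \<subseteq> B'" using assms(2) by (auto simp: saturated_def expansion_step_def)
    ultimately show ?case using step.IH by simp
  qed
  then show "completion B \<subseteq> B'" by (auto simp: completion_def)
qed


section \<open>The model constructed from a completion\<close>

text \<open>\<open>Some a\<close> and \<open>Some x\<close> stand for the names themselves, \<open>None\<close> for the new elements
  \<open>a\<^sub>\<top>\<close> and \<open>x\<^sub>\<bottom>\<close>.\<close>

type_synonym ('o, 'f, 'c, 'rb, 'rd) canonical_frame =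
  "(('o, 'c, 'rb, 'rd) obj option, ('f, 'c, 'rb, 'rd) feat option, 'rb, 'rd) frame"

type_synonym ('o, 'f, 'c, 'rb, 'rd) canonical_interp =
  "(('o, 'c, 'rb, 'rd) obj option, ('f, 'c, 'rb, 'rd) feat option, 'o, 'f, 'c, 'rb, 'rd) interp"

definition canonical_frame ::
    "('o, 'f, 'c, 'rb, 'rd) abox \<Rightarrow> ('o, 'f, 'c, 'rb, 'rd) canonical_frame" where
  "canonical_frame B =
     \<lparr>objs = insert None (Some ` obj_names B),
      feats = insert None (Some ` feat_names B),
      inc = {(Some a, Some x) | a x. Pos (IncRel a x) \<in> B},
      rbox = (\<lambda>R. {(Some a, Some x) | a x. Pos (BoxRel R a x) \<in> B}),
      rdia = (\<lambda>R. {(Some x, Some a) | x a. Pos (DiaRel R x a) \<in> B})\<rparr>"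

text \<open>\<open>f\<close>, \<open>g\<close> and \<open>h\<close> are the arbitrary interpretation of the names that do not occur in \<open>B\<close>.\<close>

definition canonical_model ::
    "('o, 'f, 'c, 'rb, 'rd) abox \<Rightarrow>
     (('o, 'c, 'rb, 'rd) obj \<Rightarrow> ('o, 'c, 'rb, 'rd) obj option) \<Rightarrow>
     (('f, 'c, 'rb, 'rd) feat \<Rightarrow> ('f, 'c, 'rb, 'rd) feat option) \<Rightarrow>
     ('c \<Rightarrow> ('o, 'c, 'rb, 'rd) obj option set \<times> ('f, 'c, 'rb, 'rd) feat option set) \<Rightarrow>
     ('o, 'f, 'c, 'rb, 'rd) canonical_interp" where
  "canonical_model B f g h =
     \<lparr>frm = canonical_frame B,
      iobj = (\<lambda>a. if a \<in> obj_names B then Some a else f a),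
      ifeat = (\<lambda>x. if x \<in> feat_names B then Some x else g x),
      iatom = (\<lambda>D. if Atom D \<in> occurring B
                    then (down (canonical_frame B) {Some (XCon (Atom D))},
                          up (canonical_frame B) {Some (ACon (Atom D))})
                    else h D)\<rparr>"

end

theory Submission
  imports Defs
begin

text \<open>
  In a saturated ABox, the relation \<open>I\<close> alone already records every other kind of positive term.
  Adjunction and \<open>I\<close>-compatibility encode \<open>b R\<^sub>\<box> y\<close> as the incidence of \<open>b\<close> with \<open>\<box>y\<close> and as that of
  the black diamond of \<open>b\<close> with \<open>y\<close>, and likewise for \<open>R\<^sub>\<diamond>\<close>. Hence every row and every column of a
  role relation is either empty or a row or column of \<open>I\<close>. Rows and columns of \<open>I\<close> are always stable,
  and the empty set is stable because the two added elements are incident with nothing; this gives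
  \<open>I\<close>-compatibility (\<open>enriched_canonical_frame\<close>).

  Creation, the basic rule and appending encode \<open>b : C\<close> as the incidence of \<open>b\<close> with \<open>x\<^sub>C\<close>, and \<open>y :: C\<close>
  as that of \<open>a\<^sub>C\<close> with \<open>y\<close>, for every occurring \<open>C\<close>. So the set of all \<open>b\<close> asserted to be in \<open>C\<close> and the
  set of all \<open>y\<close> asserted to be in \<open>C\<close> form a formal concept, generated by \<open>x\<^sub>C\<close> and by \<open>a\<^sub>C\<close>
  (\<open>asserted_concept\<close>). By induction on \<open>C\<close> this formal concept is the interpretation of \<open>C\<close>
  (\<open>truth_lemma\<close>). Since a formal concept is determined by either component, it suffices
  to compare extensions for conjunctions and boxes, and intensions for disjunctions and diamonds. The
  modal steps rest on the identifications of \<open>\<box>x\<^sub>C\<close> with the classifying feature of the box of \<open>C\<close>, and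
  of \<open>\<diamond>a\<^sub>C\<close> with the classifying object of the diamond of \<open>C\<close>.

  A positive term over names and concepts that occur therefore holds in the model exactly when it is
  present. A negative term whose
  positive counterpart were present would yield a clash: at once if it is relational, and
  otherwise after the negative rule has turned it into a negated incidence with \<open>x\<^sub>C\<close> or \<open>a\<^sub>C\<close>.
\<close>

section \<open>Formal contexts\<close>

lemma up_down_up: "B \<subseteq> objs P \<Longrightarrow> up P (down P (up P B)) = up P B"
  by (auto simp: up_def down_def polar0_def polar1_def)

lemma down_up_down: "Y \<subseteq> feats P \<Longrightarrow> down P (up P (down P Y)) = down P Y"
  by (auto simp: up_def down_def polar0_def polar1_def)

lemma stable_down: "Y \<subseteq> feats P \<Longrightarrow> stable_objs P (down P Y)"
  unfolding stable_objs_def by (simp add: down_up_down) (auto simp: down_def polar0_def)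

lemma stable_up: "B \<subseteq> objs P \<Longrightarrow> stable_feats P (up P B)"
  unfolding stable_feats_def by (simp add: up_down_up) (auto simp: up_def polar1_def)

lemma formal_concept_eqI_fst:
  assumes "formal_concept P c" "fst c = fst d" "snd d = up P (fst d)"
  shows "d = c"
  using assms by (metis formal_concept_def prod_eqI)

lemma formal_concept_eqI_snd:
  assumes "formal_concept P c" "snd c = snd d" "fst d = down P (snd d)"
  shows "d = c"
  using assms by (metis formal_concept_def prod_eqI)


section \<open>The frame of an ABox\<close>

lemma canonical_frame_simps [simp]:
  "objs (canonical_frame B) = insert None (Some ` obj_names B)"
  "feats (canonical_frame B) = insert None (Some ` feat_names B)"
  "(p, q) \<in> inc (canonical_frame B) \<longleftrightarrow>
     (\<exists>a x. p = Some a \<and> q = Some x \<and> Pos (IncRel a x) \<in> B)"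
  "(p, q) \<in> rbox (canonical_frame B) R \<longleftrightarrow>
     (\<exists>a x. p = Some a \<and> q = Some x \<and> Pos (BoxRel R a x) \<in> B)"
  "(q, p) \<in> rdia (canonical_frame B) R' \<longleftrightarrow>
     (\<exists>x a. q = Some x \<and> p = Some a \<and> Pos (DiaRel R' x a) \<in> B)"
  by (simp_all add: canonical_frame_def)

lemma names_of_term:
  assumes "t \<in> B"
  shows "a \<in> assertion_objs (assertion t) \<Longrightarrow> a \<in> obj_names B"
    and "x \<in> assertion_feats (assertion t) \<Longrightarrow> x \<in> feat_names B"
  using assms by (auto simp: obj_names_def feat_names_def)

lemma obj_namesI [intro]:
  "Pos (IncRel a x) \<in> B \<Longrightarrow> a \<in> obj_names B"
  "Pos (BoxRel R a x) \<in> B \<Longrightarrow> a \<in> obj_names B"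
  "Pos (DiaRel R' x a) \<in> B \<Longrightarrow> a \<in> obj_names B"
  "Pos (ObjIn a C) \<in> B \<Longrightarrow> a \<in> obj_names B"
  by (force dest: names_of_term(1))+

lemma feat_namesI [intro]:
  "Pos (IncRel a x) \<in> B \<Longrightarrow> x \<in> feat_names B"
  "Pos (BoxRel R a x) \<in> B \<Longrightarrow> x \<in> feat_names B"
  "Pos (DiaRel R' x a) \<in> B \<Longrightarrow> x \<in> feat_names B"
  "Pos (FeatIn x C) \<in> B \<Longrightarrow> x \<in> feat_names B"
  by (force dest: names_of_term(2))+

lemma down_canonical_feat:
  "down (canonical_frame B) {Some x} = Some ` {a. Pos (IncRel a x) \<in> B}"
  by (auto simp: down_def polar0_def)

lemma up_canonical_obj:
  "up (canonical_frame B) {Some a} = Some ` {x. Pos (IncRel a x) \<in> B}"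
  by (auto simp: up_def polar1_def)

text \<open>The element \<open>a\<^sub>\<top>\<close> has no incident feature, and \<open>x\<^sub>\<bottom>\<close> no incident object, so that the empty sets
  are stable even if some name is incident with all names.\<close>

lemma stable_empty:
  "stable_objs (canonical_frame B) {}" "stable_feats (canonical_frame B) {}"
  by (auto simp: stable_objs_def stable_feats_def up_def down_def polar0_def polar1_def)

text \<open>A special individual that occurs in no term is not an element of the frame, hence the case
  distinction: its column is empty rather than the column of an element.\<close>

lemma stable_inc_column:
  assumes "E = Some ` {a. Pos (IncRel a x) \<in> B}"
  shows "stable_objs (canonical_frame B) E"
proof (cases "x \<in> feat_names B")
  case True
  then show ?thesis
    using stable_down[of "{Some x}" "canonical_frame B"] assms by (simp add: down_canonical_feat)
next
  case False
  then have "E = {}" using assms by blast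
  then show ?thesis by (simp add: stable_empty)
qed

lemma stable_inc_row:
  assumes "Y = Some ` {x. Pos (IncRel a x) \<in> B}"
  shows "stable_feats (canonical_frame B) Y"
proof (cases "a \<in> obj_names B")
  case True
  then show ?thesis
    using stable_up[of "{Some a}" "canonical_frame B"] assms by (simp add: up_canonical_obj)
next
  case False
  then have "Y = {}" using assms by blast
  then show ?thesis by (simp add: stable_empty)
qed


section \<open>Occurring concepts\<close>

lemma subconcepts_refl: "C \<in> subconcepts C"
  by (cases C) simp_all

lemma subconcepts_trans: "D \<in> subconcepts C \<Longrightarrow> subconcepts D \<subseteq> subconcepts C"
  by (induction C) auto

lemma occurring_subconcept:
  "C \<in> occurring B \<Longrightarrow> D \<in> subconcepts C \<Longrightarrow> D \<in> occurring B"
  unfolding occurring_def by (auto dest: subsetD[OF subconcepts_trans])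

lemma occurring_of_term:
  "t \<in> B \<Longrightarrow> C \<in> assertion_concepts (assertion t) \<Longrightarrow> C \<in> occurring B"
  unfolding occurring_def using subconcepts_refl[of C] by auto


section \<open>Saturated ABoxes\<close>

locale saturated_abox =
  fixes B :: "('o, 'f, 'c, 'rb, 'rd) abox"
  assumes saturated: "saturated B"
begin

lemma closed: "expansion_rule B N \<Longrightarrow> N \<subseteq> B"
  using saturated by (auto simp: saturated_def expansion_step_def)

lemma box_iff_box_feat: "Pos (BoxRel R b y) \<in> B \<longleftrightarrow> Pos (IncRel b (box_feat R y)) \<in> B"
  using closed[OF adj_box] closed[OF compat_box] by blast

lemma box_iff_bdia_obj: "Pos (BoxRel R b y) \<in> B \<longleftrightarrow> Pos (IncRel (BDiaObj R b) y) \<in> B"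
  using closed[OF adj_box] closed[OF compat_bdia] by blast

lemma dia_iff_dia_obj: "Pos (DiaRel R y b) \<in> B \<longleftrightarrow> Pos (IncRel (dia_obj R b) y) \<in> B"
  using closed[OF adj_dia] closed[OF compat_dia] by blast

lemma dia_iff_bbox_feat: "Pos (DiaRel R y b) \<in> B \<longleftrightarrow> Pos (IncRel b (BBoxFeat R y)) \<in> B"
  using closed[OF adj_dia] closed[OF compat_bbox] by blast

lemma enriched_canonical_frame: "enriched_context RB RD (canonical_frame B)"
proof -
  let ?F = "canonical_frame B"
  have "stable_objs ?F (polar0 (objs ?F) (rbox ?F R) {q})" for R q
  proof (cases q)
    case None
    then show ?thesis using stable_empty by (simp add: polar0_def)
  next
    case (Some y)
    have "polar0 (objs ?F) (rbox ?F R) {q} = Some ` {a. Pos (IncRel a (box_feat R y)) \<in> B}"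
      unfolding Some by (auto simp: polar0_def box_iff_box_feat[symmetric])
    then show ?thesis by (rule stable_inc_column)
  qed
  moreover have "stable_feats ?F (polar1 (feats ?F) (rbox ?F R) {p})" for R p
  proof (cases p)
    case None
    then show ?thesis using stable_empty by (simp add: polar1_def)
  next
    case (Some b)
    have "polar1 (feats ?F) (rbox ?F R) {p} = Some ` {x. Pos (IncRel (BDiaObj R b) x) \<in> B}"
      unfolding Some by (auto simp: polar1_def box_iff_bdia_obj[symmetric])
    then show ?thesis by (rule stable_inc_row)
  qed
  moreover have "stable_feats ?F (polar0 (feats ?F) (rdia ?F R) {p})" for R p
  proof (cases p)
    case None
    then show ?thesis using stable_empty by (simp add: polar0_def)
  next
    case (Some b)
    have "polar0 (feats ?F) (rdia ?F R) {p} = Some ` {x. Pos (IncRel (dia_obj R b) x) \<in> B}"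
      unfolding Some by (auto simp: polar0_def dia_iff_dia_obj[symmetric])
    then show ?thesis by (rule stable_inc_row)
  qed
  moreover have "stable_objs ?F (polar1 (objs ?F) (rdia ?F R) {q})" for R q
  proof (cases q)
    case None
    then show ?thesis using stable_empty by (simp add: polar1_def)
  next
    case (Some y)
    have "polar1 (objs ?F) (rdia ?F R) {q} = Some ` {a. Pos (IncRel a (BBoxFeat R y)) \<in> B}"
      unfolding Some by (auto simp: polar1_def dia_iff_bbox_feat[symmetric])
    then show ?thesis by (rule stable_inc_column)
  qed
  moreover have "inc ?F \<subseteq> objs ?F \<times> feats ?F" "rbox ?F R \<subseteq> objs ?F \<times> feats ?F"
    "rdia ?F R' \<subseteq> feats ?F \<times> objs ?F" for R R'
    by (auto intro!: imageI)
  ultimately show ?thesis unfolding enriched_context_def formal_context_def by blast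
qed

definition asserted_objs :: "('c, 'rb, 'rd) concept \<Rightarrow> ('o, 'c, 'rb, 'rd) obj option set" where
  "asserted_objs C = Some ` {b. Pos (ObjIn b C) \<in> B}"

definition asserted_feats :: "('c, 'rb, 'rd) concept \<Rightarrow> ('f, 'c, 'rb, 'rd) feat option set" where
  "asserted_feats C = Some ` {y. Pos (FeatIn y C) \<in> B}"

lemma classifiers:
  assumes "C \<in> occurring B"
  shows "Pos (ObjIn (ACon C) C) \<in> B" "Pos (FeatIn (XCon C) C) \<in> B"
  using closed[OF creation[OF assms]] by simp_all

lemma obj_in_iff_inc:
  assumes "C \<in> occurring B"
  shows "Pos (ObjIn b C) \<in> B \<longleftrightarrow> Pos (IncRel b (XCon C)) \<in> B"
  using closed[OF append_obj, of b C] closed[OF basic, of b C "XCon C"] classifiers[OF assms] by blast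

lemma feat_in_iff_inc:
  assumes "C \<in> occurring B"
  shows "Pos (FeatIn y C) \<in> B \<longleftrightarrow> Pos (IncRel (ACon C) y) \<in> B"
  using closed[OF append_feat, of C y] closed[OF basic, of "ACon C" C y] classifiers[OF assms] by blast

text \<open>Asserted objects and asserted features are pairwise incident by the basic rule. Conversely,
  whatever is incident with all asserted features is incident with \<open>x\<^sub>C\<close>, one of them, and then
  appending asserts it; \<open>a\<^sub>C\<close> does the same for features.\<close>

lemma asserted_concept:
  assumes "C \<in> occurring B"
  shows "formal_concept (canonical_frame B) (asserted_objs C, asserted_feats C)"
proof -
  let ?F = "canonical_frame B"
  have "asserted_objs C = down ?F (asserted_feats C)"
  proof
    show "asserted_objs C \<subseteq> down ?F (asserted_feats C)"
      using closed[OF basic]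
      by (auto simp: asserted_objs_def asserted_feats_def down_def polar0_def)
    have "{Some (XCon C)} \<subseteq> asserted_feats C"
      using classifiers[OF assms] by (simp add: asserted_feats_def)
    then have "down ?F (asserted_feats C) \<subseteq> down ?F {Some (XCon C)}" by (rule down_antimono)
    also have "\<dots> = asserted_objs C"
      by (simp add: asserted_objs_def down_canonical_feat obj_in_iff_inc[OF assms])
    finally show "down ?F (asserted_feats C) \<subseteq> asserted_objs C" .
  qed
  moreover have "asserted_feats C = up ?F (asserted_objs C)"
  proof
    show "asserted_feats C \<subseteq> up ?F (asserted_objs C)"
      using closed[OF basic]
      by (auto simp: asserted_objs_def asserted_feats_def up_def polar1_def)
    have "{Some (ACon C)} \<subseteq> asserted_objs C"
      using classifiers[OF assms] by (simp add: asserted_objs_def)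
    then have "up ?F (asserted_objs C) \<subseteq> up ?F {Some (ACon C)}" by (rule up_antimono)
    also have "\<dots> = asserted_feats C"
      by (simp add: asserted_feats_def up_canonical_obj feat_in_iff_inc[OF assms])
    finally show "up ?F (asserted_objs C) \<subseteq> asserted_feats C" .
  qed
  moreover have "asserted_objs C \<subseteq> objs ?F" "asserted_feats C \<subseteq> feats ?F"
    by (auto simp: asserted_objs_def asserted_feats_def)
  ultimately show ?thesis by (simp add: formal_concept_def)
qed

lemma asserted_objs_And:
  assumes "And C1 C2 \<in> occurring B"
  shows "asserted_objs (And C1 C2) = asserted_objs C1 \<inter> asserted_objs C2"
  using closed[OF and_A, of _ C1 C2] closed[OF and_A_inv[OF _ _ assms]]
  by (auto simp: asserted_objs_def)

lemma asserted_feats_Or: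
  assumes "Or C1 C2 \<in> occurring B"
  shows "asserted_feats (Or C1 C2) = asserted_feats C1 \<inter> asserted_feats C2"
  using closed[OF or_X, of _ C1 C2] closed[OF or_X_inv[OF _ _ assms]]
  by (auto simp: asserted_feats_def)

text \<open>An object related by \<open>R\<close> to every asserted feature of \<open>C\<close> is related to \<open>x\<^sub>C\<close>. By adjunction it
  is then incident with \<open>\<box>x\<^sub>C\<close>, which is the classifying feature of \<open>Box R C\<close>, so appending puts it
  into \<open>Box R C\<close>.\<close>

lemma asserted_objs_Box:
  assumes "C \<in> occurring B"
  shows "asserted_objs (Box R C) =
    polar0 (objs (canonical_frame B)) (rbox (canonical_frame B) R) (asserted_feats C)"
    (is "_ = ?P")
proof
  show "asserted_objs (Box R C) \<subseteq> ?P"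
    using closed[OF box] by (auto simp: asserted_objs_def asserted_feats_def polar0_def)
  show "?P \<subseteq> asserted_objs (Box R C)"
  proof
    fix p assume "p \<in> ?P"
    moreover have "Some (XCon C) \<in> asserted_feats C"
      using classifiers[OF assms] by (simp add: asserted_feats_def)
    ultimately obtain b where b: "p = Some b" "Pos (BoxRel R b (XCon C)) \<in> B"
      by (auto simp: polar0_def)
    then have "Pos (IncRel b (XCon (Box R C))) \<in> B" by (simp add: box_iff_box_feat box_feat_def)
    then show "p \<in> asserted_objs (Box R C)"
      using closed[OF append_obj] b(1) by (auto simp: asserted_objs_def)
  qed
qed

lemma asserted_feats_Dia:
  assumes "C \<in> occurring B"
  shows "asserted_feats (Dia R C) =
    polar0 (feats (canonical_frame B)) (rdia (canonical_frame B) R) (asserted_objs C)"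
    (is "_ = ?P")
proof
  show "asserted_feats (Dia R C) \<subseteq> ?P"
    using closed[OF dia] by (auto simp: asserted_objs_def asserted_feats_def polar0_def)
  show "?P \<subseteq> asserted_feats (Dia R C)"
  proof
    fix q assume "q \<in> ?P"
    moreover have "Some (ACon C) \<in> asserted_objs C"
      using classifiers[OF assms] by (simp add: asserted_objs_def)
    ultimately obtain y where y: "q = Some y" "Pos (DiaRel R y (ACon C)) \<in> B"
      by (auto simp: polar0_def)
    then have "Pos (IncRel (ACon (Dia R C)) y) \<in> B" by (simp add: dia_iff_dia_obj dia_obj_def)
    then show "q \<in> asserted_feats (Dia R C)"
      using closed[OF append_feat] y(1) by (auto simp: asserted_feats_def)
  qed
qed

lemma canonical_atom:
  assumes "Atom D \<in> occurring B"
  shows "iatom (canonical_model B f g h) D = (asserted_objs (Atom D), asserted_feats (Atom D))"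
  using assms
  by (simp add: canonical_model_def down_canonical_feat up_canonical_obj
      asserted_objs_def asserted_feats_def obj_in_iff_inc feat_in_iff_inc)

text \<open>Each operation computes one component from the immediate subconcepts and closes it by \<open>up\<close> or
  \<open>down\<close> to get the other. The asserted pair is a formal concept, so its other component arises in
  the same way and only the first one has to be compared.\<close>

lemma truth_lemma:
  assumes "C \<in> occurring B"
  shows "iconcept (canonical_model B f g h) C = (asserted_objs C, asserted_feats C)"
  using assms
proof (induction C)
  case (Atom D)
  then show ?case by (simp add: canonical_atom)
next
  case (And C1 C2)
  have "C1 \<in> occurring B" "C2 \<in> occurring B"
    using occurring_subconcept[OF And.prems] by (simp_all add: subconcepts_refl)
  then show ?case
    using And.IH asserted_objs_And[OF And.prems]
    by (intro formal_concept_eqI_fst[OF asserted_concept[OF And.prems]])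
      (simp_all add: concept_meet_def canonical_model_def)
next
  case (Or C1 C2)
  have "C1 \<in> occurring B" "C2 \<in> occurring B"
    using occurring_subconcept[OF Or.prems] by (simp_all add: subconcepts_refl)
  then show ?case
    using Or.IH asserted_feats_Or[OF Or.prems]
    by (intro formal_concept_eqI_snd[OF asserted_concept[OF Or.prems]])
      (simp_all add: concept_join_def canonical_model_def)
next
  case (Dia R C)
  have "C \<in> occurring B"
    using occurring_subconcept[OF Dia.prems] by (simp add: subconcepts_refl)
  then show ?case
    using Dia.IH asserted_feats_Dia
    by (intro formal_concept_eqI_snd[OF asserted_concept[OF Dia.prems]])
      (simp_all add: concept_dia_def canonical_model_def)
next
  case (Box R C)
  have "C \<in> occurring B"
    using occurring_subconcept[OF Box.prems] by (simp add: subconcepts_refl)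
  then show ?case
    using Box.IH asserted_objs_Box
    by (intro formal_concept_eqI_fst[OF asserted_concept[OF Box.prems]])
      (simp_all add: concept_box_def canonical_model_def)
qed

text \<open>The hypothesis on \<open>t\<close> makes the names and concepts of the assertion occur in \<open>B\<close>, be it there
  positively or negated: only on them is the interpretation fixed by \<open>B\<close>.\<close>

lemma sat_assertion_iff_asserted:
  assumes "t \<in> B"
  shows "sat_assertion (canonical_model B f g h) (assertion t) \<longleftrightarrow> Pos (assertion t) \<in> B"
proof -
  have iobj: "iobj (canonical_model B f g h) b = Some b" if "b \<in> assertion_objs (assertion t)" for b
    using names_of_term(1)[OF assms that] by (simp add: canonical_model_def)
  have ifeat: "ifeat (canonical_model B f g h) y = Some y"
    if "y \<in> assertion_feats (assertion t)" for y
    using names_of_term(2)[OF assms that] by (simp add: canonical_model_def)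
  have frame: "frm (canonical_model B f g h) = canonical_frame B"
    by (simp add: canonical_model_def)
  show ?thesis
  proof (cases "assertion t")
    case (ObjIn b C)
    then have "C \<in> occurring B" using occurring_of_term[OF assms, of C] by simp
    moreover have "iobj (canonical_model B f g h) b = Some b" using iobj ObjIn by simp
    ultimately show ?thesis using ObjIn by (auto simp: truth_lemma asserted_objs_def)
  next
    case (FeatIn y C)
    then have "C \<in> occurring B" using occurring_of_term[OF assms, of C] by simp
    moreover have "ifeat (canonical_model B f g h) y = Some y" using ifeat FeatIn by simp
    ultimately show ?thesis using FeatIn by (auto simp: truth_lemma asserted_feats_def)
  qed (use iobj ifeat frame in simp_all)
qed

lemma no_opposite_terms:
  assumes "\<not> clash B" "Neg \<alpha> \<in> B"
  shows "Pos \<alpha> \<notin> B"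
proof
  assume pos: "Pos \<alpha> \<in> B"
  have relational: "Pos \<beta> \<notin> B" if "relational \<beta>" "Neg \<beta> \<in> B" for \<beta>
    using assms(1) that unfolding clash_def by blast
  show False
  proof (cases \<alpha>)
    case (ObjIn b C)
    then have "Pos (IncRel b (XCon C)) \<in> B"
      using pos occurring_of_term[OF assms(2)] by (simp add: obj_in_iff_inc)
    moreover have "Neg (IncRel b (XCon C)) \<in> B" using closed[OF neg_obj] assms(2) ObjIn by simp
    ultimately show False using relational[of "IncRel b (XCon C)"] by simp
  next
    case (FeatIn y C)
    then have "Pos (IncRel (ACon C) y) \<in> B"
      using pos occurring_of_term[OF assms(2)] by (simp add: feat_in_iff_inc)
    moreover have "Neg (IncRel (ACon C) y) \<in> B" using closed[OF neg_feat] assms(2) FeatIn by simp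
    ultimately show False using relational[of "IncRel (ACon C) y"] by simp
  qed (use relational[of \<alpha>] assms(2) pos in simp_all)
qed

lemma canonical_model_satisfies:
  assumes "\<not> clash B" "t \<in> B"
  shows "satisfies (canonical_model B f g h) t"
  using assms(2) sat_assertion_iff_asserted[OF assms(2)] no_opposite_terms[OF assms(1)]
  by (cases t) auto

lemma canonical_model_is_interp:
  assumes "\<And>a. a \<notin> obj_names B \<Longrightarrow> f a \<in> objs (canonical_frame B)"
    and "\<And>x. x \<notin> feat_names B \<Longrightarrow> g x \<in> feats (canonical_frame B)"
    and "\<And>D. Atom D \<notin> occurring B \<Longrightarrow> formal_concept (canonical_frame B) (h D)"
  shows "is_interp RB RD (canonical_model B f g h)"
proof -
  have frame: "frm (canonical_model B f g h) = canonical_frame B"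
    by (simp add: canonical_model_def)
  have "formal_concept (canonical_frame B) (iatom (canonical_model B f g h) D)" for D
  proof (cases "Atom D \<in> occurring B")
    case True
    then show ?thesis by (simp add: canonical_atom asserted_concept)
  next
    case False
    then show ?thesis using assms(3) by (simp add: canonical_model_def)
  qed
  moreover have "iobj (canonical_model B f g h) a \<in> objs (canonical_frame B)" for a
    using assms(1)[of a] by (simp add: canonical_model_def)
  moreover have "ifeat (canonical_model B f g h) x \<in> feats (canonical_frame B)" for x
    using assms(2)[of x] by (simp add: canonical_model_def)
  ultimately show ?thesis
    using enriched_canonical_frame unfolding is_interp_def frame by blast
qed

end


section \<open>Soundness of the canonical model\<close>

theorem theorem2:
  fixes \<A> :: "('o, 'f, 'c, 'rb, 'rd) abox"
    and RB :: "'rb set" and RD :: "'rd set"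
    and f :: "('o, 'c, 'rb, 'rd) obj \<Rightarrow> ('o, 'c, 'rb, 'rd) obj option"
    and g :: "('f, 'c, 'rb, 'rd) feat \<Rightarrow> ('f, 'c, 'rb, 'rd) feat option"
    and h :: "'c \<Rightarrow> ('o, 'c, 'rb, 'rd) obj option set \<times> ('f, 'c, 'rb, 'rd) feat option set"
  assumes "finite RB" and "finite RD"
    and "input_abox RB RD \<A>"
    and "\<not> clash (completion \<A>)"
    and "\<And>a. a \<notin> obj_names (completion \<A>) \<Longrightarrow> f a \<in> objs (canonical_frame (completion \<A>))"
    and "\<And>x. x \<notin> feat_names (completion \<A>) \<Longrightarrow> g x \<in> feats (canonical_frame (completion \<A>))"
    and "\<And>D. Atom D \<notin> occurring (completion \<A>) \<Longrightarrow>
           formal_concept (canonical_frame (completion \<A>)) (h D)"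
  shows "model_of RB RD (canonical_model (completion \<A>) f g h) \<A>"
proof -
  interpret saturated_abox "completion \<A>"
    by (unfold_locales) (rule saturated_completion)
  have "\<A> \<subseteq> completion \<A>" by (auto simp: completion_def)
  then have "\<forall>t\<in>\<A>. satisfies (canonical_model (completion \<A>) f g h) t"
    using canonical_model_satisfies[OF assms(4)] by blast
  moreover have "is_interp RB RD (canonical_model (completion \<A>) f g h)"
    using assms(5-7) by (rule canonical_model_is_interp)
  ultimately show ?thesis by (simp add: model_of_def)
qed

end
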